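(* Let $n,\lambda$ be positive integers. If there exists a generalized Hadamard matrix GH$(n,\lambda)$ (over some finite abelian group of order $n$), then there exists a full pairwise additive BIB design (full PAB) with parameters $$v^\ast=n\lambda,\quad b^\ast=n(n\lambda-1),\quad r^\ast=n\lambda-1,\quad k^\ast=\lambda,\quad \lambda^\ast=\lambda-1.$$
   Context: Generalized Hadamard matrices. Let $G$ be a finite abelian group of order $n$, written additively. A difference matrix DM$(n,k,\lambda)$ based on $G$ is a $k\times n\lambda$ matrix $(a_{ij})$ with entries from $G$ such that, for all $1\le i_1<i_2\le k$, the multiset $\{a_{i_1j}-a_{i_2j}\mid j=1,\dots,n\lambda\}$ contains every element of $G$ exactly $\lambda$ times. A generalized Hadamard matrix GH$(n,\lambda)$ is a DM$(n,n\lambda,\lambda)$, i.e. a difference matrix of size $n\lambda\times n\lambda$. All difference matrices are over abelian groups. Block designs. A block design BD$(v,b,r,k)$ consists of a set $V$ of $v$ points and a family (repetitions allowed) of $b$ blocks, each block being a set of $k$ different points, such that each point lies in exactly $r$ blocks. Its incidence matrix is the $v\times b$ $(0,1)$-matrix whose $(i,j)$ entry is $1$ if and only if the $i$-th point lies in the $j$-th block. A BD$(v,b,r,k)$ is a balanced incomplete block (BIB) design BIBD$(v,b,r,k,\lambda)$ if any two different points lie together in exactly $\lambda$ blocks. (Degenerate cases such as $k=1$, $\lambda=0$ and $k=v$ are allowed.) Pairwise additive BIB designs. A PAB$(\ell;v,k,\lambda)$, with associated $b$ and $r$, is a set of $\ell$ matrices $N_1,\dots,N_\ell$ of size $v\times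 b$, $N_h=(a^{(h)}_{ij})$, such that each $N_h$ is the incidence matrix of a BIBD$(v,b,r,k,\lambda)$, $a^{(h_1)}_{ij}a^{(h_2)}_{ij}=0$ for all $i,j$ and all distinct $h_1,h_2$, and for all distinct $h_1,h_2$ the matrix $N_{h_1}+N_{h_2}$ is the incidence matrix of a BIBD with parameters $(v,\,b,\,2r,\,2k,\,2r(2k-1)/(v-1))$. A full PAB with parameters $v,b,r,k,\lambda$ is a PAB$(\ell;v,k,\lambda)$ (with these $b$ and $r$) for which $\ell=v/k$. *)

theory Defs
  imports "Jordan_Normal_Form.Matrix" "HOL-Algebra.Coset" "HOL-Library.Multiset"
begin

text \<open>
  The abelian group is a \<^locale>\<open>comm_group\<close>, so the difference \<open>a - b\<close> of the additive
  notation reads \<open>a \<otimes> inv b\<close>.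
\<close>

definition difference_matrix ::
    "('a, 'c) monoid_scheme \<Rightarrow> nat \<Rightarrow> nat \<Rightarrow> nat \<Rightarrow> 'a mat \<Rightarrow> bool" where
  "difference_matrix G n k lam A \<longleftrightarrow>
     comm_group G \<and> finite (carrier G) \<and> card (carrier G) = n \<and>
     A \<in> carrier_mat k (n * lam) \<and> elements_mat A \<subseteq> carrier G \<and>
     (\<forall>i1 i2. i1 < i2 \<and> i2 < k \<longrightarrow>
       (\<forall>g \<in> carrier G.
          count {# A $$ (i1, j) \<otimes>\<^bsub>G\<^esub> inv\<^bsub>G\<^esub> A $$ (i2, j). j \<in># mset_set {0..<n * lam} #} g = lam))"

definition generalized_hadamard ::
    "('a, 'c) monoid_scheme \<Rightarrow> nat \<Rightarrow> nat \<Rightarrow> 'a mat \<Rightarrow> bool" where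
  "generalized_hadamard G n lam A \<longleftrightarrow> difference_matrix G n (n * lam) lam A"

text \<open>
  The family of blocks is a list, so repeated blocks are allowed and count separately.
\<close>

definition block_design ::
    "'p set \<Rightarrow> 'p set list \<Rightarrow> nat \<Rightarrow> nat \<Rightarrow> nat \<Rightarrow> nat \<Rightarrow> bool" where
  "block_design V Bs v b r k \<longleftrightarrow>
     finite V \<and> card V = v \<and> length Bs = b \<and>
     (\<forall>B \<in> set Bs. B \<subseteq> V \<and> card B = k) \<and>
     (\<forall>x \<in> V. card {j. j < b \<and> x \<in> Bs ! j} = r)"

definition bibd ::
    "'p set \<Rightarrow> 'p set list \<Rightarrow> nat \<Rightarrow> nat \<Rightarrow> nat \<Rightarrow> nat \<Rightarrow> nat \<Rightarrow> bool" where
  "bibd V Bs v b r k lam \<longleftrightarrow>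
     block_design V Bs v b r k \<and>
     (\<forall>x \<in> V. \<forall>y \<in> V. x \<noteq> y \<longrightarrow> card {j. j < b \<and> x \<in> Bs ! j \<and> y \<in> Bs ! j} = lam)"

text \<open>The list \<open>ps\<close> enumerates the points, without repetition where it is used below.\<close>

definition incidence_matrix :: "'p list \<Rightarrow> 'p set list \<Rightarrow> nat mat" where
  "incidence_matrix ps Bs =
     mat (length ps) (length Bs) (\<lambda>(i, j). if ps ! i \<in> Bs ! j then 1 else 0)"

text \<open>
  The names of the points do not affect an incidence matrix, so it is no restriction to take
  them in \<^typ>\<open>nat\<close>.
\<close>

definition is_bibd_incidence_matrix ::
    "nat mat \<Rightarrow> nat \<Rightarrow> nat \<Rightarrow> nat \<Rightarrow> nat \<Rightarrow> nat \<Rightarrow> bool" where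
  "is_bibd_incidence_matrix N v b r k lam \<longleftrightarrow>
     (\<exists>(ps :: nat list) Bs. distinct ps \<and> bibd (set ps) Bs v b r k lam \<and>
        N = incidence_matrix ps Bs)"

text \<open>
  The index \<open>2r(2k-1)/(v-1)\<close> of the sums is computed in the rationals, and is required to
  be the natural number \<open>mu\<close>.
\<close>

definition pab ::
    "nat \<Rightarrow> nat \<Rightarrow> nat \<Rightarrow> nat \<Rightarrow> nat \<Rightarrow> nat \<Rightarrow> nat mat set \<Rightarrow> bool" where
  "pab l v b r k lam NN \<longleftrightarrow>
     finite NN \<and> card NN = l \<and>
     (\<forall>N \<in> NN. is_bibd_incidence_matrix N v b r k lam) \<and>
     (\<forall>N1 \<in> NN. \<forall>N2 \<in> NN. N1 \<noteq> N2 \<longrightarrow>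
        (\<forall>i < v. \<forall>j < b. N1 $$ (i, j) * N2 $$ (i, j) = 0) \<and>
        (\<exists>mu :: nat.
           (of_nat mu :: rat) = 2 * of_nat r * (2 * of_nat k - 1) / (of_nat v - 1) \<and>
           is_bibd_incidence_matrix (N1 + N2) v b (2 * r) (2 * k) mu))"

definition full_pab ::
    "nat \<Rightarrow> nat \<Rightarrow> nat \<Rightarrow> nat \<Rightarrow> nat \<Rightarrow> nat mat set \<Rightarrow> bool" where
  "full_pab v b r k lam NN \<longleftrightarrow>
     (\<exists>l. (of_nat l :: rat) = of_nat v / of_nat k \<and> pab l v b r k lam NN)"

end

theory Submission
  imports Defs "Jordan_Normal_Form.Determinant"
begin

text \<open>
  Replacing each entry of the matrix by its regular permutation matrix, and projecting away the
  constant vectors of the group algebra, gives a square matrix \<open>U\<close> that is a multiple of an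
  isometry on the remaining space. Its left inverse is also a right inverse, so the
  columns of a generalized Hadamard matrix have balanced differences, just like its rows.
  Normalize the first row to zero. The points are the columns, and for a group element \<open>h\<close>
  the blocks are the sets of columns \<open>j\<close> with \<open>d\<^sub>i\<^sub>j = g + h\<close>, one for each row \<open>i > 0\<close> and each
  \<open>g\<close>. Balanced columns say that any two points meet in the right number of blocks; the same count
  for \<open>d\<^sub>i\<^sub>j - g \<in> S\<close> with \<open>S\<close> a set of size 1 or 2 covers the designs and their pairwise sums.
\<close>

section \<open>Inverse matrices over finite index sets, and counting in lists and products\<close>

text \<open>An enumeration of \<open>I\<close> turns both functions into square matrices over a
  field, where a one-sided inverse is two-sided. An arbitrary finite \<open>I\<close> allows pairs
  (row, group element) as indices.\<close>

lemma finite_matrix_left_right_inverse: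
  fixes f g :: "'i \<Rightarrow> 'i \<Rightarrow> 'b :: field"
  assumes fin: "finite I"
    and inv: "\<And>p q. p \<in> I \<Longrightarrow> q \<in> I \<Longrightarrow> (\<Sum>r\<in>I. f p r * g r q) = of_bool (p = q)"
    and "p \<in> I" "q \<in> I"
  shows "(\<Sum>r\<in>I. g p r * f r q) = of_bool (p = q)"
proof -
  define N where "N = card I"
  obtain e where e: "bij_betw e {0..<N} I"
    using ex_bij_betw_nat_finite[OF fin] N_def by blast
  have inj: "e i = e j \<longleftrightarrow> i = j" if "i < N" "j < N" for i j
    using e that by (auto simp: bij_betw_def inj_on_def)
  have eI: "e i \<in> I" if "i < N" for i
    using e that by (auto simp: bij_betw_def)
  define F where "F = mat N N (\<lambda>(i, j). f (e i) (e j))"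
  define H where "H = mat N N (\<lambda>(i, j). g (e i) (e j))"
  have car: "F \<in> carrier_mat N N" "H \<in> carrier_mat N N"
    by (auto simp: F_def H_def)
  have FH: "(F * H) $$ (i, j) = (\<Sum>r\<in>I. f (e i) r * g r (e j))" if "i < N" "j < N" for i j
    using that by (simp add: F_def H_def scalar_prod_def sum.reindex_bij_betw[OF e, symmetric])
  have HF: "(H * F) $$ (i, j) = (\<Sum>r\<in>I. g (e i) r * f r (e j))" if "i < N" "j < N" for i j
    using that by (simp add: F_def H_def scalar_prod_def sum.reindex_bij_betw[OF e, symmetric])
  have "F * H = 1\<^sub>m N"
  proof (rule eq_matI)
    fix i j assume "i < dim_row (1\<^sub>m N)" "j < dim_col (1\<^sub>m N)"
    then show "(F * H) $$ (i, j) = 1\<^sub>m N $$ (i, j)"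
      using FH inv[OF eI eI] inj by simp
  qed (use car in auto)
  then have 1: "H * F = 1\<^sub>m N"
    using mat_mult_left_right_inverse car by blast
  obtain i j where ij: "i < N" "p = e i" "j < N" "q = e j"
    using e assms(3,4) by (force simp: bij_betw_def)
  show ?thesis
    using HF[of i j] ij 1 inj[of i j] by (auto split: if_splits)
qed

text \<open>A design counts positions in its list of blocks. The blocks may repeat, but their labels
  do not, so this turns such counts into counts of labels.\<close>

lemma card_nth_distinct:
  assumes "distinct xs"
  shows "card {j. j < length xs \<and> P (xs ! j)} = card {x \<in> set xs. P x}"
proof -
  have "card {j. j < length xs \<and> P (xs ! j)} = length (filter P xs)"
    by (simp add: length_filter_conv_card)
  also have "\<dots> = card (set (filter P xs))"
    using assms by (metis distinct_card distinct_filter)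
  finally show ?thesis by simp
qed

lemma card_Collect_Sigma:
  assumes "finite A" "\<And>x. x \<in> A \<Longrightarrow> finite {y \<in> B. P x y}"
  shows "card {(x, y) \<in> A \<times> B. P x y} = (\<Sum>x\<in>A. card {y \<in> B. P x y})"
proof -
  have "{(x, y) \<in> A \<times> B. P x y} = (SIGMA x:A. {y \<in> B. P x y})"
    by auto
  then show ?thesis
    using assms by simp
qed

section \<open>Inner products of centered indicators\<close>

lemma sum_centered_indicator:
  fixes c :: "'b :: field"
  assumes "finite S" "x \<in> S" "c * of_nat (card S) = 1"
  shows "(\<Sum>h\<in>S. of_bool (x = h) - c) = 0"
  using assms by (simp add: sum_subtractf of_bool_def mult.commute)

text \<open>\<open>of_bool (x = h) - c\<close> is the unit vector at \<open>x\<close> projected to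
  the vectors with sum zero. The projection is symmetric and idempotent, so inner products of its
  columns are again its entries.\<close>

lemma sum_centered_indicator_mult:
  fixes c :: "'b :: field"
  assumes "finite S" "x \<in> S" "y \<in> S" "c * of_nat (card S) = 1"
  shows "(\<Sum>h\<in>S. (of_bool (x = h) - c) * (of_bool (y = h) - c)) = of_bool (x = y) - c"
proof -
  have "(\<Sum>h\<in>S. (of_bool (x = h) - c) * (of_bool (y = h) - c))
      = (\<Sum>h\<in>S. (if x = h then of_bool (y = h) - c else 0)) - c * (\<Sum>h\<in>S. of_bool (y = h) - c)"
    unfolding sum_distrib_left sum_subtractf[symmetric]
    by (rule sum.cong) (auto simp: algebra_simps)
  also have "\<dots> = of_bool (y = x) - c"
    using assms by (simp add: sum_centered_indicator)
  finally show ?thesis by (simp add: eq_commute)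
qed

text \<open>The correction term is the identity on the vectors that are constant on each \<open>{i} \<times> S\<close>.\<close>

lemma sum_mult_corrected:
  fixes c d :: "'b :: field"
  assumes "finite J" "finite S" "i \<in> J" "i' \<in> J" "c * of_nat (card S) = 1"
    and "\<And>j. j \<in> J \<Longrightarrow> (\<Sum>h\<in>S. u j h) = 0" "\<And>j. j \<in> J \<Longrightarrow> (\<Sum>h\<in>S. w j h) = 0"
  shows "(\<Sum>j\<in>J. \<Sum>h\<in>S. (u j h + of_bool (i = j) * c) * (w j h * d + of_bool (i' = j) * c))
       = (\<Sum>j\<in>J. \<Sum>h\<in>S. u j h * w j h) * d + of_bool (i = i') * c"
proof -
  have "(\<Sum>h\<in>S. (u j h + of_bool (i = j) * c) * (w j h * d + of_bool (i' = j) * c))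
      = (\<Sum>h\<in>S. u j h * w j h) * d + (if i = j then of_bool (i' = i) * c else 0)" if "j \<in> J" for j
  proof -
    \<comment> \<open>The two mixed terms vanish by the zero sums. In the last term
      \<open>c * of_nat (card S) = 1\<close> removes one factor \<open>c\<close>.\<close>
    have "(\<Sum>h\<in>S. (u j h + of_bool (i = j) * c) * (w j h * d + of_bool (i' = j) * c))
        = (\<Sum>h\<in>S. u j h * w j h) * d + (\<Sum>h\<in>S. u j h) * (of_bool (i' = j) * c)
          + (\<Sum>h\<in>S. w j h) * (d * of_bool (i = j) * c)
          + of_bool (i = j) * of_bool (i' = j) * c * (c * of_nat (card S))"
      by (simp add: sum.distrib sum_distrib_right sum_distrib_left algebra_simps)
    then show ?thesis
      using assms that by auto
  qed
  then have "(\<Sum>j\<in>J. \<Sum>h\<in>S. (u j h + of_bool (i = j) * c) * (w j h * d + of_bool (i' = j) * c))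
      = (\<Sum>j\<in>J. (\<Sum>h\<in>S. u j h * w j h) * d + (if i = j then of_bool (i' = i) * c else 0))"
    by (intro sum.cong refl)
  also have "\<dots> = (\<Sum>j\<in>J. \<Sum>h\<in>S. u j h * w j h) * d + of_bool (i' = i) * c"
    using assms by (simp add: sum.distrib flip: sum_distrib_right)
  finally show ?thesis
    unfolding eq_commute[of i' i] .
qed

section \<open>Balanced columns from balanced rows\<close>

locale balanced_rows = comm_group G for G (structure) +
  fixes a :: "nat \<Rightarrow> nat \<Rightarrow> 'a" and lam :: nat and m :: nat
  assumes fin: "finite (carrier G)"
    and lam_pos: "lam > 0"
    and m_def: "m = card (carrier G) * lam"
    and a_closed: "i < m \<Longrightarrow> j < m \<Longrightarrow> a i j \<in> carrier G"
    and rows: "i < m \<Longrightarrow> i' < m \<Longrightarrow> i \<noteq> i' \<Longrightarrow> g \<in> carrier G \<Longrightarrow>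
      card {j \<in> {..<m}. a i j \<otimes> inv a i' j = g} = lam"
begin

lemma eq_mult_iff:
  assumes "x \<in> carrier G" "y \<in> carrier G" "g \<in> carrier G" "h \<in> carrier G"
  shows "x \<otimes> g = y \<otimes> h \<longleftrightarrow> x \<otimes> inv y = h \<otimes> inv g"
proof -
  have "x \<otimes> g = y \<otimes> h \<longleftrightarrow> x = y \<otimes> h \<otimes> inv g"
    using assms by (metis inv_solve_right m_closed)
  also have "\<dots> \<longleftrightarrow> x = y \<otimes> (h \<otimes> inv g)"
    using assms by (simp add: m_assoc)
  also have "\<dots> \<longleftrightarrow> x \<otimes> inv y = h \<otimes> inv g"
    using assms by (metis inv_closed inv_solve_right' m_closed m_comm)
  finally show ?thesis .
qed

lemma card_pos: "card (carrier G) > 0"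
  using fin one_closed by (auto simp: card_gt_0_iff)

lemma m_pos: "m > 0"
  using card_pos lam_pos by (simp add: m_def)

text \<open>The entry of \<open>U\<close> in row \<open>(i, g)\<close> and column
  \<open>(j, h)\<close>: block \<open>(i, j)\<close> is the permutation matrix of translation by
  \<open>a i j\<close>, minus the projection to the constant vectors.\<close>

definition centered :: "nat \<Rightarrow> 'a \<Rightarrow> nat \<Rightarrow> 'a \<Rightarrow> real" where
  "centered i g j h = of_bool (a i j \<otimes> h = g) - 1 / card (carrier G)"

lemma centered_alt:
  assumes "i < m" "j < m" "g \<in> carrier G" "h \<in> carrier G"
  shows "centered i g j h = of_bool (inv a i j \<otimes> g = h) - 1 / card (carrier G)"
proof -
  have "a i j \<otimes> h = g \<longleftrightarrow> inv a i j \<otimes> g = h"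
    using assms a_closed by (metis inv_solve_left m_closed inv_closed)
  then show ?thesis
    by (simp add: centered_def)
qed

lemma sum_centered_row:
  assumes "i < m" "j < m" "g \<in> carrier G"
  shows "(\<Sum>h\<in>carrier G. centered i g j h) = 0"
proof -
  have "(\<Sum>h\<in>carrier G. centered i g j h)
      = (\<Sum>h\<in>carrier G. of_bool (inv a i j \<otimes> g = h) - 1 / card (carrier G))"
    using assms by (intro sum.cong) (auto simp: centered_alt)
  also have "\<dots> = 0"
    using assms fin a_closed card_pos by (intro sum_centered_indicator) auto
  finally show ?thesis .
qed

lemma sum_centered_col:
  assumes "i < m" "j < m" "h \<in> carrier G"
  shows "(\<Sum>g\<in>carrier G. centered i g j h) = 0"
  unfolding centered_def using assms fin a_closed card_pos
  by (intro sum_centered_indicator) auto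

lemma m_div: "real m / card (carrier G) = lam"
  using card_pos by (simp add: m_def)

text \<open>This is \<open>U\<close> times its transpose. Summing over \<open>h\<close> leaves, for
  each \<open>j\<close>, the indicator of one difference minus \<open>1 / n\<close> with
  \<open>n = card (carrier G)\<close>. For different rows the indicators add up to
  \<open>lam\<close>, which \<open>m / n\<close> cancels.\<close>

lemma sum_centered_row_row:
  assumes "i < m" "i' < m" "g \<in> carrier G" "g' \<in> carrier G"
  shows "(\<Sum>j<m. \<Sum>h\<in>carrier G. centered i g j h * centered i' g' j h)
    = of_bool (i = i') * (real m * of_bool (g = g') - lam)"
proof -
  have *: "inv a i j \<otimes> g = inv a i' j \<otimes> g' \<longleftrightarrow> a i j \<otimes> inv a i' j = g \<otimes> inv g'" if "j < m" for j
  proof -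
    have cl: "a i j \<in> carrier G" "a i' j \<in> carrier G"
      using assms a_closed that by auto
    have "inv a i j \<otimes> g = g \<otimes> inv a i j" "inv a i' j \<otimes> g' = g' \<otimes> inv a i' j"
      "inv a i' j \<otimes> a i j = a i j \<otimes> inv a i' j"
      using cl assms by (auto intro: m_comm)
    then show ?thesis
      using eq_mult_iff[of g g' "inv a i j" "inv a i' j"] cl assms by auto
  qed
  have "(\<Sum>h\<in>carrier G. centered i g j h * centered i' g' j h)
      = of_bool (a i j \<otimes> inv a i' j = g \<otimes> inv g') - 1 / card (carrier G)" if "j < m" for j
  proof -
    have "(\<Sum>h\<in>carrier G. centered i g j h * centered i' g' j h)
      = (\<Sum>h\<in>carrier G. (of_bool (inv a i j \<otimes> g = h) - 1 / card (carrier G))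
          * (of_bool (inv a i' j \<otimes> g' = h) - 1 / card (carrier G)))"
      using assms that by (intro sum.cong) (auto simp: centered_alt)
    also have "\<dots> = of_bool (inv a i j \<otimes> g = inv a i' j \<otimes> g') - 1 / card (carrier G)"
      using assms that fin a_closed card_pos
      by (intro sum_centered_indicator_mult) auto
    finally show ?thesis using * that by simp
  qed
  then have "(\<Sum>j<m. \<Sum>h\<in>carrier G. centered i g j h * centered i' g' j h)
    = real (card {j \<in> {..<m}. a i j \<otimes> inv a i' j = g \<otimes> inv g'}) - lam"
    using m_div by (simp add: sum_subtractf Int_def)
  also have "\<dots> = of_bool (i = i') * (real m * of_bool (g = g') - lam)"
  proof (cases "i = i'")
    case True
    \<comment> \<open>A row minus itself is constantly \<open>\<one>\<close>, so the count is
      \<open>m\<close> or 0.\<close>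
    have "a i j \<otimes> inv a i j = g \<otimes> inv g' \<longleftrightarrow> g = g'" if "j < m" for j
      using eq_mult_iff[of g g' \<one> \<one>] assms a_closed that by auto
    then have "{j \<in> {..<m}. a i j \<otimes> inv a i j = g \<otimes> inv g'} = (if g = g' then {..<m} else {})"
      by auto
    then show ?thesis using True by simp
  qed (use rows assms in simp)
  finally show ?thesis .
qed

text \<open>This is the transpose of \<open>U\<close> times \<open>U\<close>, left in terms of the
  very count of rows that column balance is about.\<close>

lemma sum_centered_col_col:
  assumes "j < m" "j' < m" "h \<in> carrier G" "h' \<in> carrier G"
  shows "(\<Sum>i<m. \<Sum>g\<in>carrier G. centered i g j h * centered i g j' h')
    = real (card {i \<in> {..<m}. a i j \<otimes> h = a i j' \<otimes> h'}) - lam"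
proof -
  have "(\<Sum>g\<in>carrier G. centered i g j h * centered i g j' h')
      = of_bool (a i j \<otimes> h = a i j' \<otimes> h') - 1 / card (carrier G)" if "i < m" for i
    unfolding centered_def using assms that fin a_closed card_pos
    by (intro sum_centered_indicator_mult) auto
  then show ?thesis
    using m_div by (simp add: sum_subtractf Int_def)
qed

text \<open>With \<open>P\<close> the averaging over the group inside each diagonal block,
  \<open>U\<close> times its transpose is \<open>m * (1 - P)\<close>. Hence \<open>U + P\<close> has
  the right inverse \<open>transpose U / m + P\<close>. This is also a left inverse, and an entry of
  that second product outside the diagonal blocks gives the count.\<close>

lemma columns:
  assumes "j < m" "j' < m" "j \<noteq> j'" "g \<in> carrier G"
  shows "card {i \<in> {..<m}. a i j \<otimes> inv a i j' = g} = lam"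
proof -
  define c where "c = 1 / real (card (carrier G))"
  define I where "I = {..<m} \<times> carrier G"
  \<comment> \<open>\<open>U\<close> alone is singular, as it kills the vectors constant on each
    block. Adding the averaging projection, with entries \<open>c\<close> on the diagonal blocks,
    repairs this. \<open>Y\<close> takes its indices in transposed order.\<close>
  define X where "X = (\<lambda>p q. centered (fst p) (snd p) (fst q) (snd q) + of_bool (fst p = fst q) * c)"
  define Y where "Y = (\<lambda>q p. centered (fst p) (snd p) (fst q) (snd q) * (1 / m) + of_bool (fst p = fst q) * c)"
  have c: "c * of_nat (card (carrier G)) = 1"
    using card_pos by (simp add: c_def)
  have XY: "(\<Sum>r\<in>I. X p r * Y r q) = of_bool (p = q)" if pq: "p \<in> I" "q \<in> I" for p q
  proof -
    obtain i g i' g' where p: "p = (i, g)" "q = (i', g')" by fastforce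
    have "(\<Sum>r\<in>I. X p r * Y r q) = (\<Sum>j<m. \<Sum>h\<in>carrier G.
       (centered i g j h + of_bool (i = j) * c) * (centered i' g' j h * (1 / m) + of_bool (i' = j) * c))"
      unfolding I_def p X_def Y_def sum.cartesian_product by (simp add: case_prod_unfold)
    also have "\<dots> = (\<Sum>j<m. \<Sum>h\<in>carrier G. centered i g j h * centered i' g' j h) * (1 / m) + of_bool (i = i') * c"
      using pq p fin c by (intro sum_mult_corrected) (auto simp: I_def sum_centered_row)
    also have "\<dots> = of_bool (i = i') * (of_bool (g = g') - real lam / m + c)"
      using pq p m_pos by (subst sum_centered_row_row) (auto simp: I_def field_simps)
    \<comment> \<open>What \<open>U\<close> misses of the identity is exactly what the correction
      \<open>c\<close> supplies.\<close>
    also have "real lam / m = c"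
      using lam_pos by (simp add: c_def m_def)
    finally show ?thesis
      using p by auto
  qed
  have *: "(j, \<one>) \<in> I" "(j', g) \<in> I"
    using assms by (auto simp: I_def)
  \<comment> \<open>As \<open>j \<noteq> j'\<close>, both the identity entry and the correction term
    are zero, so the count must equal \<open>lam\<close>. The components \<open>\<one>\<close> and
    \<open>g\<close> select the difference \<open>g\<close>.\<close>
  have "0 = (\<Sum>r\<in>I. Y (j', g) r * X r (j, \<one>))"
    using finite_matrix_left_right_inverse[of I X Y "(j', g)" "(j, \<one>)"] XY * assms fin
    by (simp add: I_def)
  also have "\<dots> = (\<Sum>i<m. \<Sum>x\<in>carrier G. (centered i x j \<one> + of_bool (j = i) * c)
      * (centered i x j' g * (1 / m) + of_bool (j' = i) * c))"
    unfolding I_def X_def Y_def sum.cartesian_product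
    by (simp add: case_prod_unfold mult.commute eq_commute)
  also have "\<dots> = (\<Sum>i<m. \<Sum>x\<in>carrier G. centered i x j \<one> * centered i x j' g) * (1 / m) + of_bool (j = j') * c"
    using assms fin c by (intro sum_mult_corrected) (auto simp: sum_centered_col)
  also have "\<dots> = (real (card {i \<in> {..<m}. a i j \<otimes> \<one> = a i j' \<otimes> g}) - lam) / m"
    using assms by (simp add: sum_centered_col_col)
  finally have "card {i \<in> {..<m}. a i j \<otimes> \<one> = a i j' \<otimes> g} = lam"
    using m_pos by simp
  moreover have "{i \<in> {..<m}. a i j \<otimes> \<one> = a i j' \<otimes> g} = {i \<in> {..<m}. a i j \<otimes> inv a i j' = g}"
    using assms eq_mult_iff[OF a_closed a_closed one_closed] by auto
  ultimately show ?thesis by simp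
qed

section \<open>Normalization of the first row\<close>

definition nrm :: "nat \<Rightarrow> nat \<Rightarrow> 'a" where
  "nrm i j = a i j \<otimes> inv a 0 j"

lemma nrm_closed: "i < m \<Longrightarrow> j < m \<Longrightarrow> nrm i j \<in> carrier G"
  using a_closed m_pos by (simp add: nrm_def)

lemma nrm_0: "j < m \<Longrightarrow> nrm 0 j = \<one>"
  using a_closed m_pos by (simp add: nrm_def)

text \<open>An entry of \<open>nrm\<close> is itself a difference between row \<open>i\<close> and
  row 0.\<close>

lemma nrm_row:
  "0 < i \<Longrightarrow> i < m \<Longrightarrow> g \<in> carrier G \<Longrightarrow> card {j \<in> {..<m}. nrm i j = g} = lam"
  unfolding nrm_def using rows m_pos by simp

text \<open>Normalization shifts all differences of two fixed columns by the same group element, so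
  only the target \<open>g\<close> moves.\<close>

lemma nrm_col:
  assumes "j < m" "j' < m" "j \<noteq> j'" "g \<in> carrier G"
  shows "card {i \<in> {..<m}. nrm i j \<otimes> inv nrm i j' = g} = lam"
proof -
  have "nrm i j \<otimes> inv nrm i j' = g
      \<longleftrightarrow> a i j \<otimes> inv a i j' = g \<otimes> (a 0 j \<otimes> inv a 0 j')" if "i < m" for i
  proof -
    have cl: "a i j \<in> carrier G" "a i j' \<in> carrier G" "a 0 j \<in> carrier G" "a 0 j' \<in> carrier G"
      using that assms a_closed m_pos by auto
    have "nrm i j \<otimes> inv nrm i j' = (a i j \<otimes> inv a i j') \<otimes> inv (a 0 j \<otimes> inv a 0 j')"
      unfolding nrm_def using cl by (simp add: inv_mult m_ac)
    then show ?thesis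
      using cl assms by (metis inv_closed inv_solve_right' m_closed)
  qed
  then have "{i \<in> {..<m}. nrm i j \<otimes> inv nrm i j' = g}
      = {i \<in> {..<m}. a i j \<otimes> inv a i j' = g \<otimes> (a 0 j \<otimes> inv a 0 j')}"
    by auto
  then show ?thesis
    using columns assms a_closed m_pos by simp
qed

text \<open>The omitted row 0 has difference \<open>\<one>\<close> in every pair of columns, so just
  this value loses one occurrence.\<close>

lemma nrm_col_pos:
  assumes "j < m" "j' < m" "j \<noteq> j'" "g \<in> carrier G"
  shows "card {i \<in> {1..<m}. nrm i j \<otimes> inv nrm i j' = g} = lam - of_bool (g = \<one>)"
proof -
  have "{i \<in> {1..<m}. nrm i j \<otimes> inv nrm i j' = g}
      = {i \<in> {..<m}. nrm i j \<otimes> inv nrm i j' = g} - (if g = \<one> then {0} else {})"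
    using nrm_0 assms by (auto simp: Suc_le_eq intro: gr0I)
  moreover have "g = \<one> \<Longrightarrow> 0 \<in> {i \<in> {..<m}. nrm i j \<otimes> inv nrm i j' = g}"
    using nrm_0 assms m_pos by auto
  ultimately show ?thesis
    using nrm_col[OF assms] by (cases "g = \<one>") (simp_all add: card_Diff_singleton)
qed

section \<open>Blocks and their counts\<close>

definition elts :: "'a list" where
  "elts = (SOME gs. set gs = carrier G \<and> distinct gs)"

lemma elts: "set elts = carrier G" "distinct elts"
proof -
  have "set elts = carrier G \<and> distinct elts"
    unfolding elts_def by (rule someI_ex) (rule finite_distinct_list[OF fin])
  then show "set elts = carrier G" "distinct elts" by auto
qed

text \<open>The labels of the blocks. Row 0 is left out because it is constant after normalization:
  its blocks would be empty or contain all points.\<close>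

definition cells :: "(nat \<times> 'a) list" where
  "cells = List.product [1..<m] elts"

lemma cells:
  "set cells = {1..<m} \<times> carrier G" "distinct cells" "length cells = card (carrier G) * (m - 1)"
  using elts distinct_card[OF elts(2)] by (auto simp: cells_def distinct_product)

definition blk :: "'a set \<Rightarrow> nat \<times> 'a \<Rightarrow> nat set" where
  "blk S = (\<lambda>(i, g). {j \<in> {..<m}. nrm i j \<otimes> inv g \<in> S})"

text \<open>The map sending \<open>s\<close> to \<open>x \<otimes> inv s\<close> is an involution of
  the group, hence its own inverse between the two sets.\<close>

lemma card_translate:
  assumes "S \<subseteq> carrier G" "x \<in> carrier G"
  shows "card {g \<in> carrier G. x \<otimes> inv g \<in> S} = card S"
proof -
  have "bij_betw (\<lambda>s. x \<otimes> inv s) S {g \<in> carrier G. x \<otimes> inv g \<in> S}"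
  proof (rule bij_betw_byWitness[where f' = "\<lambda>g. x \<otimes> inv g"])
    have *: "x \<otimes> inv (x \<otimes> inv s) = s" if "s \<in> carrier G" for s
      using assms that by (simp add: inv_mult m_assoc[symmetric])
    show "\<forall>s\<in>S. x \<otimes> inv (x \<otimes> inv s) = s" "\<forall>g\<in>{g \<in> carrier G. x \<otimes> inv g \<in> S}. x \<otimes> inv (x \<otimes> inv g) = g"
      using * assms by auto
    show "(\<lambda>s. x \<otimes> inv s) ` S \<subseteq> {g \<in> carrier G. x \<otimes> inv g \<in> S}"
      using * assms by (auto simp: subset_iff)
  qed auto
  then show ?thesis
    by (metis bij_betw_same_card)
qed

text \<open>A block splits into the classes \<open>nrm i j = s \<otimes> g\<close> for
  \<open>s \<in> S\<close>, and each has \<open>lam\<close> points since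
  \<open>i > 0\<close>.\<close>

lemma card_blk:
  assumes S: "S \<subseteq> carrier G" and c: "c \<in> set cells"
  shows "card (blk S c) = card S * lam"
proof -
  obtain i g where ig: "c = (i, g)" "0 < i" "i < m" "g \<in> carrier G"
    using c cells by auto
  have finS: "finite S" using S fin finite_subset by blast
  have "nrm i j \<otimes> inv g = s \<longleftrightarrow> nrm i j = s \<otimes> g" if "j < m" "s \<in> S" for j s
    using that ig S nrm_closed by (metis inv_solve_right' subset_iff)
  then have "blk S c = (\<Union>s\<in>S. {j \<in> {..<m}. nrm i j = s \<otimes> g})"
    by (auto simp: blk_def ig)
  moreover have "card (\<Union>s\<in>S. {j \<in> {..<m}. nrm i j = s \<otimes> g})
      = (\<Sum>s\<in>S. card {j \<in> {..<m}. nrm i j = s \<otimes> g})"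
    using finS S ig by (intro card_UN_disjoint) (auto simp: subset_iff)
  ultimately show ?thesis
    using S ig nrm_row by (simp add: subset_iff)
qed

lemma card_cells_point:
  assumes "S \<subseteq> carrier G" "j < m"
  shows "card {c \<in> set cells. j \<in> blk S c} = card S * (m - 1)"
proof -
  have "{c \<in> set cells. j \<in> blk S c} = {(i, g) \<in> {1..<m} \<times> carrier G. nrm i j \<otimes> inv g \<in> S}"
    using assms by (auto simp: cells blk_def)
  also have "card \<dots> = (\<Sum>i\<in>{1..<m}. card {g \<in> carrier G. nrm i j \<otimes> inv g \<in> S})"
    using fin by (intro card_Collect_Sigma) auto
  also have "\<dots> = (\<Sum>i\<in>{1..<m}. card S)"
    using assms nrm_closed by (intro sum.cong) (auto simp: card_translate)
  finally show ?thesis by simp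
qed

text \<open>
  A cell \<open>(i, g)\<close> whose block contains both points is determined by \<open>i\<close> and the pair
  \<open>(x, y) = (d\<^sub>i\<^sub>j - g, d\<^sub>i\<^sub>j\<^sub>' - g)\<close> in \<open>S \<times> S\<close>, and the pairs that occur are those with
  \<open>d\<^sub>i\<^sub>j - d\<^sub>i\<^sub>j\<^sub>' = x - y\<close>.
\<close>

lemma card_cells_pair:
  assumes S: "S \<subseteq> carrier G" and j: "j < m" "j' < m" "j \<noteq> j'"
  shows "card {c \<in> set cells. j \<in> blk S c \<and> j' \<in> blk S c} = card S * (card S * lam - 1)"
proof -
  have finS: "finite S" using S fin finite_subset by blast
  let ?L = "{c \<in> set cells. j \<in> blk S c \<and> j' \<in> blk S c}"
  let ?R = "{(p, i) \<in> (S \<times> S) \<times> {1..<m}. nrm i j \<otimes> inv nrm i j' = fst p \<otimes> inv snd p}"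
  have inv1: "x \<otimes> inv (x \<otimes> inv g) = g" if "x \<in> carrier G" "g \<in> carrier G" for x g
    using that by (simp add: inv_mult m_assoc[symmetric])
  have inv2: "y \<otimes> inv (x \<otimes> inv s) = t"
    if "x \<in> carrier G" "y \<in> carrier G" "s \<in> carrier G" "t \<in> carrier G" "x \<otimes> inv y = s \<otimes> inv t" for x y s t
  proof -
    have "x \<otimes> t = y \<otimes> s"
      using that eq_mult_iff by blast
    moreover have "y \<otimes> inv (x \<otimes> inv s) = inv x \<otimes> (y \<otimes> s)"
      using that by (simp add: inv_mult m_ac)
    ultimately have "y \<otimes> inv (x \<otimes> inv s) = inv x \<otimes> (x \<otimes> t)" by simp
    then show "y \<otimes> inv (x \<otimes> inv s) = t"
      using that by (simp add: m_assoc[symmetric])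
  qed
  have diff: "(x \<otimes> inv g) \<otimes> inv (y \<otimes> inv g) = x \<otimes> inv y"
    if "x \<in> carrier G" "y \<in> carrier G" "g \<in> carrier G" for x y g
    using that eq_mult_iff[of "x \<otimes> inv g" "y \<otimes> inv g" y x] by (simp add: m_ac)
  \<comment> \<open>The inverse recovers \<open>g\<close> from \<open>i\<close> and the first
    component of the pair. By the equation defining \<open>?R\<close>, the second component then
    agrees as well.\<close>
  have "bij_betw (\<lambda>(i, g). ((nrm i j \<otimes> inv g, nrm i j' \<otimes> inv g), i)) ?L ?R"
  proof (rule bij_betw_byWitness[where f' = "\<lambda>(p, i). (i, nrm i j \<otimes> inv fst p)"])
    show "\<forall>c\<in>?L. (\<lambda>(p, i). (i, nrm i j \<otimes> inv fst p)) ((\<lambda>(i, g). ((nrm i j \<otimes> inv g, nrm i j' \<otimes> inv g), i)) c) = c"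
      using inv1 nrm_closed j by (auto simp: cells)
    show "\<forall>c\<in>?R. (\<lambda>(i, g). ((nrm i j \<otimes> inv g, nrm i j' \<otimes> inv g), i)) ((\<lambda>(p, i). (i, nrm i j \<otimes> inv fst p)) c) = c"
      using inv1 inv2[OF nrm_closed nrm_closed] S j nrm_closed by (auto simp: subset_iff)
    show "(\<lambda>(i, g). ((nrm i j \<otimes> inv g, nrm i j' \<otimes> inv g), i)) ` ?L \<subseteq> ?R"
      using diff nrm_closed j by (auto simp: cells blk_def)
    show "(\<lambda>(p, i). (i, nrm i j \<otimes> inv fst p)) ` ?R \<subseteq> ?L"
    proof -
      have "nrm i j' \<otimes> inv (nrm i j \<otimes> inv x) \<in> S"
        if "x \<in> S" "y \<in> S" "i < m" "nrm i j \<otimes> inv nrm i j' = x \<otimes> inv y" for i x y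
        using inv2[of "nrm i j" "nrm i j'" x y] that S j nrm_closed by (simp add: subset_iff)
      then show ?thesis
        using inv1 S j nrm_closed by (auto simp: cells blk_def subset_iff)
    qed
  qed
  then have "card ?L = card ?R"
    by (rule bij_betw_same_card)
  also have "\<dots> = (\<Sum>p\<in>S \<times> S. card {i \<in> {1..<m}. nrm i j \<otimes> inv nrm i j' = fst p \<otimes> inv snd p})"
    using finS by (intro card_Collect_Sigma) auto
  \<comment> \<open>The pairs with difference \<open>\<one>\<close> are the diagonal ones, and these
    are the pairs affected by leaving out row 0.\<close>
  also have "\<dots> = (\<Sum>p\<in>S \<times> S. lam - of_bool (fst p = snd p))"
  proof (rule sum.cong)
    fix p assume "p \<in> S \<times> S"
    then have p: "fst p \<in> carrier G" "snd p \<in> carrier G" using S by auto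
    then have "fst p \<otimes> inv snd p = \<one> \<longleftrightarrow> fst p = snd p"
      using eq_mult_iff[of "fst p" "snd p" \<one> \<one>] by simp
    then show "card {i \<in> {1..<m}. nrm i j \<otimes> inv nrm i j' = fst p \<otimes> inv snd p} = lam - of_bool (fst p = snd p)"
      using nrm_col_pos[OF j] p by simp
  qed simp
  also have "\<dots> = (\<Sum>x\<in>S. \<Sum>y\<in>S. lam - of_bool (x = y))"
    by (simp add: sum.cartesian_product case_prod_unfold)
  also have "\<dots> = (\<Sum>x\<in>S. card S * lam - 1)"
  proof (rule sum.cong)
    fix x assume x: "x \<in> S"
    \<comment> \<open>Subtraction is on naturals: \<open>lam > 0\<close> ensures that nothing is
      truncated, and exactly one \<open>y\<close> loses a unit.\<close>
    have "(\<Sum>y\<in>S. lam - of_bool (x = y)) + (\<Sum>y\<in>S. of_bool (x = y)) = (\<Sum>y\<in>S. lam)"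
      unfolding sum.distrib[symmetric] using lam_pos by (intro sum.cong) auto
    moreover have "(\<Sum>y\<in>S. of_bool (x = y)) = (1::nat)"
      using x finS by (simp add: of_bool_def)
    ultimately show "(\<Sum>y\<in>S. lam - of_bool (x = y)) = card S * lam - 1"
      by simp
  qed simp
  finally show ?thesis by simp
qed

section \<open>Incidence matrices and their pairwise sums\<close>

definition design :: "'a set \<Rightarrow> nat mat" where
  "design S = incidence_matrix [0..<m] (map (blk S) cells)"

text \<open>The three counts of cells and points are the parameters. A set \<open>S\<close> of size
  1 gives \<open>r = m - 1\<close>, \<open>k = lam\<close> and index \<open>lam - 1\<close>; size 2
  doubles \<open>r\<close> and \<open>k\<close> and gives index
  \<open>2 * (2 * lam - 1)\<close>.\<close>

lemma design_bibd:
  assumes "S \<subseteq> carrier G"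
  shows "is_bibd_incidence_matrix (design S) m (card (carrier G) * (m - 1))
    (card S * (m - 1)) (card S * lam) (card S * (card S * lam - 1))"
proof -
  have "card {j. j < card (carrier G) * (m - 1) \<and> P (map (blk S) cells ! j)}
      = card {c \<in> set cells. P (blk S c)}" for P
    using card_nth_distinct[OF cells(2), of "\<lambda>c. P (blk S c)"] cells(3) by (simp cong: conj_cong)
  note count = this
  have "bibd (set [0..<m]) (map (blk S) cells) m (card (carrier G) * (m - 1))
    (card S * (m - 1)) (card S * lam) (card S * (card S * lam - 1))"
    unfolding bibd_def block_design_def
  proof (intro conjI ballI impI)
    fix B assume "B \<in> set (map (blk S) cells)"
    then obtain c where c: "c \<in> set cells" "B = blk S c" by auto
    then show "B \<subseteq> set [0..<m]" "card B = card S * lam"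
      using card_blk[OF assms] by (auto simp: blk_def split: prod.splits)
  next
    fix x assume "x \<in> set [0..<m]"
    then show "card {j. j < card (carrier G) * (m - 1) \<and> x \<in> map (blk S) cells ! j} = card S * (m - 1)"
      using count[of "\<lambda>B. x \<in> B"] card_cells_point[OF assms] by simp
  next
    fix x y assume "x \<in> set [0..<m]" "y \<in> set [0..<m]" "x \<noteq> y"
    then show "card {j. j < card (carrier G) * (m - 1) \<and> x \<in> map (blk S) cells ! j \<and> y \<in> map (blk S) cells ! j}
      = card S * (card S * lam - 1)"
      using count[of "\<lambda>B. x \<in> B \<and> y \<in> B"] card_cells_pair[OF assms] by simp
  qed (auto simp: cells)
  then show ?thesis
    unfolding is_bibd_incidence_matrix_def design_def by (metis distinct_upt)
qed

lemma design_index: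
  assumes "i < m" "j < card (carrier G) * (m - 1)"
  shows "design S $$ (i, j) = of_bool (nrm (fst (cells ! j)) i \<otimes> inv snd (cells ! j) \<in> S)"
  using assms cells(3) by (auto simp: design_def incidence_matrix_def blk_def case_prod_unfold)

lemma design_carrier: "design S \<in> carrier_mat m (card (carrier G) * (m - 1))"
  using cells(3) by (simp add: design_def incidence_matrix_def)

text \<open>For disjoint sets a point lies in at most one of the two blocks of a cell, so the sum is
  again the matrix of a design of this form.\<close>

lemma design_add:
  assumes "S \<inter> T = {}"
  shows "design S + design T = design (S \<union> T)"
  using assms design_carrier[of S] design_carrier[of T] design_carrier[of "S \<union> T"]
  by (intro eq_matI) (auto simp: design_index)

lemma design_mult:
  assumes "S \<inter> T = {}" "i < m" "j < card (carrier G) * (m - 1)"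
  shows "design S $$ (i, j) * design T $$ (i, j) = 0"
  using assms by (auto simp: design_index)

text \<open>The family is a set of matrices, so its size is the group order only if different
  elements give different matrices.\<close>

lemma inj_design: "inj_on (\<lambda>h. design {h}) (carrier G)"
proof (rule inj_onI)
  fix h h' assume h: "h \<in> carrier G" "h' \<in> carrier G" and eq: "design {h} = design {h'}"
  show "h = h'"
  proof (rule ccontr)
    assume ne: "h \<noteq> h'"
    \<comment> \<open>Two different elements force \<open>m > 1\<close>, so row 1 exists. It takes
      the value \<open>h\<close> at some column \<open>i\<close>, and there the cell
      \<open>(1, \<one>)\<close> separates the two matrices.\<close>
    have "card {h, h'} \<le> card (carrier G)"
      using h fin by (intro card_mono) auto
    then have "1 < m"
      using ne lam_pos unfolding m_def by (cases lam) auto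
    then have "(1, \<one>) \<in> set cells" by (auto simp: cells)
    then obtain j where j: "j < card (carrier G) * (m - 1)" "cells ! j = (1, \<one>)"
      using cells(3) by (auto simp: in_set_conv_nth)
    have "card {j \<in> {..<m}. nrm 1 j = h} \<noteq> 0"
      using nrm_row[of 1 h] h \<open>1 < m\<close> lam_pos by simp
    then obtain i where i: "i < m" "nrm 1 i = h"
      by (auto simp: card_eq_0_iff)
    have "design {h} $$ (i, j) \<noteq> design {h'} $$ (i, j)"
      using i j h ne by (simp add: design_index)
    then show False using eq by simp
  qed
qed

text \<open>One design per group element makes the family full, as \<open>m / lam\<close> is the
  group order. The sum of the designs of \<open>h\<close> and \<open>h'\<close> is the design of
  \<open>{h, h'}\<close>.\<close>

lemma full_pab_designs:
  "full_pab m (card (carrier G) * (m - 1)) (m - 1) lam (lam - 1) ((\<lambda>h. design {h}) ` carrier G)"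
  unfolding full_pab_def pab_def
proof (intro exI conjI ballI impI)
  show "(of_nat (card (carrier G)) :: rat) = of_nat m / of_nat lam"
    using lam_pos by (simp add: m_def)
  show "finite ((\<lambda>h. design {h}) ` carrier G)"
    using fin by simp
  show "card ((\<lambda>h. design {h}) ` carrier G) = card (carrier G)"
    using inj_design by (rule card_image)
  show "is_bibd_incidence_matrix N m (card (carrier G) * (m - 1)) (m - 1) lam (lam - 1)"
    if "N \<in> (\<lambda>h. design {h}) ` carrier G" for N
    using that design_bibd[of "{h}" for h] by fastforce
next
  fix N1 N2
  assume N: "N1 \<in> (\<lambda>h. design {h}) ` carrier G" "N2 \<in> (\<lambda>h. design {h}) ` carrier G" "N1 \<noteq> N2"
  then obtain h h' where h: "h \<in> carrier G" "h' \<in> carrier G" "h \<noteq> h'"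
    "N1 = design {h}" "N2 = design {h'}" by auto
  show "\<forall>i<m. \<forall>j<card (carrier G) * (m - 1). N1 $$ (i, j) * N2 $$ (i, j) = 0"
    using h design_mult[of "{h}" "{h'}"] by simp
  \<comment> \<open>Here \<open>r = v - 1 = m - 1\<close>, so the required index reduces to
    \<open>2 * (2 * lam - 1)\<close>. Cancelling needs \<open>m > 1\<close>, which holds because the
    group has two different elements.\<close>
  have "card {h, h'} \<le> card (carrier G)"
    using h fin by (intro card_mono) auto
  then have "1 < m"
    using h lam_pos unfolding m_def by (cases lam) auto
  then show "(of_nat (2 * (2 * lam - 1)) :: rat)
      = 2 * of_nat (m - 1) * (2 * of_nat lam - 1) / (of_nat m - 1)"
    using lam_pos by (simp add: of_nat_diff divide_simps) (simp add: algebra_simps)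
  show "is_bibd_incidence_matrix (N1 + N2) m (card (carrier G) * (m - 1))
      (2 * (m - 1)) (2 * lam) (2 * (2 * lam - 1))"
    using design_bibd[of "{h, h'}"] design_add[of "{h}" "{h'}"] h by (simp add: insert_commute mult_2)
qed

end

section \<open>From a generalized Hadamard matrix to the construction\<close>

text \<open>A difference matrix constrains only \<open>i1 < i2\<close>. Exchanging two rows inverts
  every difference, and the count for \<open>inv g\<close> is \<open>lam\<close> as well.\<close>

lemma difference_matrix_row_card:
  fixes G (structure)
  assumes A: "difference_matrix G n k lam A"
    and i: "i < k" "i' < k" "i \<noteq> i'" and g: "g \<in> carrier G"
  shows "card {j \<in> {..<n * lam}. A $$ (i, j) \<otimes> inv A $$ (i', j) = g} = lam"
proof -
  interpret comm_group G using A by (simp add: difference_matrix_def)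
  have cl: "A $$ (i, j) \<in> carrier G" if "i < k" "j < n * lam" for i j
    using A that by (auto simp: difference_matrix_def)
  have lt: "card {j \<in> {..<n * lam}. A $$ (i, j) \<otimes> inv A $$ (i', j) = g} = lam"
    if "i < i'" "i' < k" "g \<in> carrier G" for i i' g
  proof -
    have "count {# A $$ (i, j) \<otimes> inv A $$ (i', j). j \<in># mset_set {0..<n * lam} #} g = lam"
      using A that by (simp add: difference_matrix_def)
    then show ?thesis
      by (simp add: count_image_mset_eq_card_vimage lessThan_atLeast0)
  qed
  show ?thesis
  proof (cases "i < i'")
    case False
    have "A $$ (i, j) \<otimes> inv A $$ (i', j) = g \<longleftrightarrow> A $$ (i', j) \<otimes> inv A $$ (i, j) = inv g"
      if "j < n * lam" for j
    proof -
      have "A $$ (i', j) \<otimes> inv A $$ (i, j) = inv (A $$ (i, j) \<otimes> inv A $$ (i', j))"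
        using that cl i by (simp add: inv_mult m_comm)
      then show ?thesis
        using that cl i g by (metis inv_inv inv_closed m_closed)
    qed
    then have "{j \<in> {..<n * lam}. A $$ (i, j) \<otimes> inv A $$ (i', j) = g}
        = {j \<in> {..<n * lam}. A $$ (i', j) \<otimes> inv A $$ (i, j) = inv g}"
      by auto
    then show ?thesis using lt[of i' i "inv g"] False i g by simp
  qed (use lt i g in blast)
qed

theorem theorem4p3:
  fixes n lam :: nat and G :: "('a, 'c) monoid_scheme"
  assumes "n > 0" and "lam > 0"
    and "\<exists>A. generalized_hadamard G n lam A"
  shows "\<exists>NN. full_pab (n * lam) (n * (n * lam - 1)) (n * lam - 1) lam (lam - 1) NN"
proof -
  obtain A where A: "difference_matrix G n (n * lam) lam A"
    using assms(3) by (auto simp: generalized_hadamard_def)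
  then have n: "card (carrier G) = n" and "comm_group G" and "finite (carrier G)"
    and cl: "A \<in> carrier_mat (n * lam) (n * lam)" "elements_mat A \<subseteq> carrier G"
    by (auto simp: difference_matrix_def)
  then interpret comm_group G by simp
  interpret balanced_rows G "\<lambda>i j. A $$ (i, j)" lam "n * lam"
  proof unfold_locales
    show "A $$ (i, j) \<in> carrier G" if "i < n * lam" "j < n * lam" for i j
      using cl that by auto
  qed (use n \<open>finite (carrier G)\<close> assms(2) difference_matrix_row_card[OF A] in auto)
  show ?thesis
    using full_pab_designs n by auto
qed

end
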